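(* Let $X\subseteq\mathbb{R}^n$ be compact, let $\mathbb{I}=\{S_i\}_{i=1}^N$ be an affine iterated function system on $X$ with affinity dimension $s$, and let $C\subseteq X$ be a non-empty compact set. Let $F_\emptyset$ be the homogeneous attractor of $\mathbb{I}$ and $F_C$ the inhomogeneous attractor of $\mathbb{I}$ with condensation set $C$. If $s\le 1$, then $$\max\{\overline{\dim}_B F_\emptyset,\ \overline{\dim}_B C\}\ \le\ \overline{\dim}_B F_C\ \le\ \max\{s,\ \overline{\dim}_B C\}.$$
   Context: An affine IFS on a compact set $X\subseteq\mathbb{R}^n$ (with the Euclidean metric) is a finite collection of maps $S_i(x)=A_ix+v_i$, $i=1,\dots,N$, with $A_i$ an invertible linear map of $\mathbb{R}^n$ of Euclidean operator norm $<1$, $v_i\in\mathbb{R}^n$, and $S_i(X)\subseteq X$. The homogeneous attractor $F_\emptyset$ is the unique non-empty compact set with $F_\emptyset=\bigcup_{i=1}^N S_i(F_\emptyset)$. For compact $C\subseteq X$, the inhomogeneous attractor $F_C$ with condensation set $C$ is the unique non-empty compact set with $F_C=\bigcup_{i=1}^N S_i(F_C)\cup C$. Affinity dimension: for an invertible linear map $A$ of $\mathbb{R}^n$ with singular values $\alpha_1\ge\cdots\ge\alpha_n>0$, the singular value function is $\phi^0(A)=1$, $\phi^t(A)=\alpha_1\cdots\alpha_{m-1}\alpha_m^{\,t-m+1}$ for $m-1<t\le m$ with $m\in\{1,\dots,n\}$ (so $\phi^t(A)=\alpha_1^t$ for $0\le t\le1$), and $\phi^t(A)=|\det A|^{t/n}$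 for $t>n$. The affinity dimension of $\mathbb{I}$ is the unique $s\ge0$ with $\lim_{k\to\infty}\frac1k\log\sum_{(i_1,\dots,i_k)\in\{1,\dots,N\}^k}\phi^s(A_{i_1}\cdots A_{i_k})=0$. For a non-empty set $F$, $\overline{\dim}_B F=\limsup_{\delta\to0}\frac{\log N_\delta(F)}{-\log\delta}$, where $N_\delta(F)$ is the minimum number of balls of diameter $\delta$ required to cover $F$. *)

theory Defs
  imports "HOL-Analysis.Analysis" "HOL-Library.Multiset"
begin

definition affine_map :: "real^'n^'n \<Rightarrow> real^'n \<Rightarrow> real^'n \<Rightarrow> real^'n" where
  "affine_map A v x = A *v x + v"

definition affine_ifs ::
    "(real^'n) set \<Rightarrow> nat \<Rightarrow> (nat \<Rightarrow> real^'n^'n) \<Rightarrow> (nat \<Rightarrow> real^'n) \<Rightarrow> bool" where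
  "affine_ifs X N A v \<longleftrightarrow>
     N \<ge> 1 \<and>
     (\<forall>i\<in>{1..N}. invertible (A i) \<and> onorm ((*v) (A i)) < 1 \<and> affine_map (A i) (v i) ` X \<subseteq> X)"

(* The homogeneous attractor is the case C = {}.  Existence and uniqueness of F (for
   contractions S i and compact C) are facts, not part of the definition. *)
definition is_attractor ::
    "nat \<Rightarrow> (nat \<Rightarrow> 'a \<Rightarrow> 'a) \<Rightarrow> 'a set \<Rightarrow> 'a::metric_space set \<Rightarrow> bool" where
  "is_attractor N S C F \<longleftrightarrow> compact F \<and> F \<noteq> {} \<and> F = (\<Union>i\<in>{1..N}. S i ` F) \<union> C"

definition eigenspace :: "real^'n^'n \<Rightarrow> real \<Rightarrow> (real^'n) set" where
  "eigenspace M l = {x. M *v x = l *\<^sub>R x}"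

(* Square roots of the eigenvalues of A^T A in decreasing order, listed with multiplicity.
   A^T A is symmetric, so geometric and algebraic multiplicities agree and the list has
   length CARD('n). *)
definition singular_values :: "real^'n^'n \<Rightarrow> real list" where
  "singular_values A =
     (let M = transpose A ** A in
      rev (sorted_list_of_multiset
        (\<Sum>l\<in>{l. eigenspace M l \<noteq> {0}}. replicate_mset (dim (eigenspace M l)) (sqrt l))))"

(* Indexed from 1: singular_value A 1 is the largest one. *)
definition singular_value :: "real^'n^'n \<Rightarrow> nat \<Rightarrow> real" where
  "singular_value A j = singular_values A ! (j - 1)"

(* For 0 < t, the condition m - 1 < t \<le> m on a natural number m says m = \<lceil>t\<rceil>.
   Only t \<ge> 0 is meaningful. *)
definition singular_value_function :: "real \<Rightarrow> real^'n^'n \<Rightarrow> real" where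
  "singular_value_function t A =
     (if t \<le> 0 then 1
      else if t \<le> real CARD('n) then
        (let m = nat \<lceil>t\<rceil> in
         (\<Prod>j\<in>{1..<m}. singular_value A j) * singular_value A m powr (t - real m + 1))
      else \<bar>det A\<bar> powr (t / real CARD('n)))"

definition word_matrix :: "(nat \<Rightarrow> real^'n^'n) \<Rightarrow> nat list \<Rightarrow> real^'n^'n" where
  "word_matrix A w = foldr (\<lambda>i B. A i ** B) w (mat 1)"

definition is_affinity_dimension :: "nat \<Rightarrow> (nat \<Rightarrow> real^'n^'n) \<Rightarrow> real \<Rightarrow> bool" where
  "is_affinity_dimension N A s \<longleftrightarrow>
     s \<ge> 0 \<and>
     (\<lambda>k. (1 / real k) *
        ln (\<Sum>w | length w = k \<and> set w \<subseteq> {1..N}. singular_value_function s (word_matrix A w)))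
       \<longlonglongrightarrow> 0"

(* Balls of diameter \<delta> are closed balls of radius \<delta>/2; meaningful for totally bounded F. *)
definition covering_number :: "real \<Rightarrow> 'a::metric_space set \<Rightarrow> nat" where
  "covering_number \<delta> F =
     (LEAST k. \<exists>P. finite P \<and> card P = k \<and> F \<subseteq> (\<Union>x\<in>P. cball x (\<delta> / 2)))"

definition upper_box_dim :: "'a::metric_space set \<Rightarrow> ereal" where
  "upper_box_dim F =
     Limsup (at_right 0) (\<lambda>\<delta>. ereal (ln (real (covering_number \<delta> F)) / - ln \<delta>))"

end

theory Submission
  imports Defs
begin

text \<open>For \<open>0 < \<delta> < 1\<close> let \<open>W\<close> be the finite, prefix-closed set of words \<open>w\<close> with
  \<open>\<parallel>A\<^sub>w\<parallel> > \<delta>\<close>.  Iterating the attractor equation along \<open>W\<close> covers \<open>F\<^sub>C\<close> by the sets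
  \<open>S\<^sub>w C\<close> with \<open>w \<in> W\<close> and by the sets \<open>S\<^sub>w F\<^sub>C\<close> with \<open>w\<close> a minimal word outside \<open>W\<close>.  For
  \<open>t > max {s, dim C}\<close> a set of the first kind needs \<open>O((\<delta> / \<parallel>A\<^sub>w\<parallel>)\<^sup>-\<^sup>t)\<close> balls of diameter \<open>\<delta>\<close>
  and one of the second kind needs \<open>O(1)\<close>, so everything is \<open>O(\<delta>\<^sup>-\<^sup>t)\<close> once
  \<open>\<Sum>\<^sub>w \<parallel>A\<^sub>w\<parallel>\<^sup>t < \<infinity>\<close>.  Since \<open>s \<le> 1\<close>, the singular value function is \<open>\<parallel>A\<^sub>w\<parallel>\<^sup>s\<close>, and the
  uniform contraction turns subexponential growth of its sums at \<open>s\<close> into summability at \<open>t\<close>.\<close>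

section \<open>The largest singular value\<close>

lemma norm_matrix_vector_le:
  fixes B :: "real^'n^'m"
  shows "norm (B *v x) \<le> onorm ((*v) B) * norm x"
  by (rule onorm[OF matrix_vector_mul_bounded_linear])

lemma onorm_matrix_mul_le:
  fixes B :: "real^'n^'m" and B' :: "real^'k^'n"
  shows "onorm ((*v) (B ** B')) \<le> onorm ((*v) B) * onorm ((*v) B')"
  using onorm_compose[of "(*v) B" "(*v) B'"]
  by (simp add: o_def matrix_vector_mul_assoc matrix_vector_mul_bounded_linear)

text \<open>Writing \<open>z\<close> for the transpose of \<open>B\<close> applied to
  \<open>y\<close>, the squared norm of \<open>z\<close> equals the inner product of
  \<open>y\<close> with \<open>B *v z\<close>. Cauchy-Schwarz bounds this, and one factor
  \<open>norm z\<close> cancels.\<close>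

lemma norm_transpose_vector_le:
  fixes B :: "real^'n^'m"
  shows "norm (transpose B *v y) \<le> onorm ((*v) B) * norm y"
proof (cases "transpose B *v y = 0")
  case True
  then show ?thesis
    by (simp add: onorm_pos_le[OF matrix_vector_mul_bounded_linear])
next
  case False
  let ?z = "transpose B *v y"
  have "norm ?z * norm ?z = ?z \<bullet> ?z"
    by (simp add: dot_square_norm power2_eq_square)
  also have "\<dots> = y \<bullet> (B *v ?z)"
    by (metis dot_lmul_matrix inner_commute transpose_matrix_vector vector_transpose_matrix)
  also have "\<dots> \<le> norm y * norm (B *v ?z)"
    by (rule norm_cauchy_schwarz)
  also have "\<dots> \<le> norm y * (onorm ((*v) B) * norm ?z)"
    by (intro mult_left_mono norm_matrix_vector_le) simp
  finally have "norm ?z * norm ?z \<le> (onorm ((*v) B) * norm y) * norm ?z"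
    by (simp add: mult_ac)
  with False show ?thesis
    by (simp add: mult_le_cancel_right)
qed

text \<open>The unit sphere is compact, and by homogeneity the maximum of
  \<open>norm (B *v x)\<close> on it bounds \<open>B\<close> everywhere.\<close>

lemma onorm_attained:
  fixes B :: "real^'n^'m"
  obtains x where "norm x = 1" "norm (B *v x) = onorm ((*v) B)"
proof -
  have "continuous_on (sphere 0 1) (\<lambda>x. norm (B *v x))"
    by (intro continuous_intros linear_continuous_on matrix_vector_mul_bounded_linear)
  moreover have "(sphere 0 1 :: (real^'n) set) \<noteq> {}"
    by simp
  ultimately obtain x where x: "x \<in> sphere 0 1"
      "\<And>y. y \<in> sphere 0 1 \<Longrightarrow> norm (B *v y) \<le> norm (B *v x)"
    using continuous_attains_sup[of "sphere 0 1"] by (metis compact_sphere)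
  have "onorm ((*v) B) \<le> norm (B *v x)"
  proof (rule onorm_le)
    fix y :: "real^'n"
    show "norm (B *v y) \<le> norm (B *v x) * norm y"
    proof (cases "y = 0")
      case False
      then have "norm (B *v ((1 / norm y) *\<^sub>R y)) \<le> norm (B *v x)"
        by (intro x(2)) simp
      with False show ?thesis
        by (simp add: matrix_vector_mult_scaleR field_simps)
    qed simp
  qed
  moreover have "norm (B *v x) \<le> onorm ((*v) B)"
    using norm_matrix_vector_le[of B x] x(1) by simp
  ultimately show ?thesis
    using x(1) by (intro that[of x]) auto
qed

text \<open>A unit vector at which the operator norm \<open>b\<close> is attained is an eigenvector
  of the Gram matrix: its image \<open>z\<close> has norm at most \<open>b^2\<close> and inner
  product exactly \<open>b^2\<close> with \<open>x\<close>, which forces \<open>z\<close> to be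
  \<open>b^2\<close> times \<open>x\<close>.\<close>

lemma onorm_square_eigenvalue:
  fixes B :: "real^'n^'n"
  shows "eigenspace (transpose B ** B) ((onorm ((*v) B))\<^sup>2) \<noteq> {0}"
proof -
  obtain x where x: "norm x = 1" "norm (B *v x) = onorm ((*v) B)"
    by (rule onorm_attained)
  define b where "b = onorm ((*v) B)"
  let ?z = "transpose B *v (B *v x)"
  have b: "b \<ge> 0" "norm (B *v x) = b"
    using x(2) unfolding b_def by (metis norm_ge_zero, simp)
  have "norm ?z \<le> b\<^sup>2"
    using norm_transpose_vector_le[of B "B *v x"] b by (simp add: b_def power2_eq_square)
  then have z: "?z \<bullet> ?z \<le> (b\<^sup>2)\<^sup>2"
    unfolding dot_square_norm by (intro power_mono) auto
  have "?z \<bullet> x = (B *v x) \<bullet> (B *v x)"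
    by (metis dot_lmul_matrix inner_commute transpose_matrix_vector vector_transpose_matrix)
  then have zx: "?z \<bullet> x = b\<^sup>2"
    using b by (simp add: dot_square_norm)
  have xx: "x \<bullet> x = 1"
    using x(1) by (simp add: dot_square_norm)
  \<comment> \<open>The cross terms contribute -2 b^4 and the last square contributes b^4.\<close>
  have "(?z - b\<^sup>2 *\<^sub>R x) \<bullet> (?z - b\<^sup>2 *\<^sub>R x) = ?z \<bullet> ?z - (b\<^sup>2)\<^sup>2"
    using zx xx by (simp add: inner_diff_left inner_diff_right inner_commute power2_eq_square)
  with z have "(?z - b\<^sup>2 *\<^sub>R x) \<bullet> (?z - b\<^sup>2 *\<^sub>R x) \<le> 0"
    by simp
  then have "?z = b\<^sup>2 *\<^sub>R x"
    by (simp add: dot_square_norm)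
  then have "x \<in> eigenspace (transpose B ** B) (b\<^sup>2)"
    by (simp add: eigenspace_def matrix_vector_mul_assoc)
  moreover have "x \<noteq> 0"
    using x(1) by auto
  ultimately show ?thesis
    unfolding b_def by auto
qed

text \<open>The sum defining \<open>singular_values\<close> runs over this set and would collapse to
  the empty multiset if the set were infinite. Eigenvectors of a symmetric matrix for distinct
  eigenvalues are orthogonal, so choosing one for each eigenvalue is injective with finite
  image.\<close>

lemma finite_eigenvalues_gram:
  fixes B :: "real^'n^'n"
  shows "finite {l. eigenspace (transpose B ** B) l \<noteq> {0}}" (is "finite ?E")
proof -
  let ?M = "transpose B ** B"
  have sym: "(?M *v x) \<bullet> y = x \<bullet> (?M *v y)" for x y
    by (metis dot_lmul_matrix inner_commute transpose_matrix_vector vector_transpose_matrix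
        matrix_vector_mul_assoc)
  have "\<exists>x. x \<noteq> 0 \<and> ?M *v x = l *\<^sub>R x" if "l \<in> ?E" for l
  proof -
    have "0 \<in> eigenspace ?M l"
      by (simp add: eigenspace_def)
    with that show ?thesis
      by (auto simp: eigenspace_def)
  qed
  then obtain e where e: "\<And>l. l \<in> ?E \<Longrightarrow> e l \<noteq> 0 \<and> ?M *v e l = l *\<^sub>R e l"
    by metis
  have orth: "e l \<bullet> e k = 0" if "l \<in> ?E" "k \<in> ?E" "l \<noteq> k" for l k
    using sym[of "e l" "e k"] e[OF that(1)] e[OF that(2)] that(3) by simp
  have "inj_on e ?E"
    using e orth by (intro inj_onI) (metis inner_eq_zero_iff)
  moreover have "pairwise orthogonal (e ` ?E)"
    using orth by (auto simp: pairwise_def orthogonal_def)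
  then have "finite (e ` ?E)"
    by (rule pairwise_orthogonal_imp_finite)
  ultimately show ?thesis
    using finite_imageD by blast
qed

text \<open>The eigenvalue \<open>b^2\<close> has an eigenspace of positive dimension, so
  \<open>b\<close> occurs in the multiset; the head of the reversed sorted list is its
  maximum.\<close>

lemma onorm_le_singular_value_1:
  fixes B :: "real^'n^'n"
  shows "onorm ((*v) B) \<le> singular_value B 1"
proof -
  define M where "M = transpose B ** B"
  define E where "E = {l. eigenspace M l \<noteq> {0}}"
  define Q where "Q = (\<Sum>l\<in>E. replicate_mset (dim (eigenspace M l)) (sqrt l))"
  define b where "b = onorm ((*v) B)"
  have b0: "b \<ge> 0"
    unfolding b_def by (rule onorm_pos_le[OF matrix_vector_mul_bounded_linear])
  have "finite E"
    unfolding E_def M_def by (rule finite_eigenvalues_gram)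
  have bE: "b\<^sup>2 \<in> E"
    using onorm_square_eigenvalue[of B] by (simp add: E_def M_def b_def)
  have "0 \<in> eigenspace M (b\<^sup>2)"
    by (simp add: eigenspace_def)
  with bE have "dim (eigenspace M (b\<^sup>2)) \<noteq> 0"
    by (auto simp: E_def)
  then have "b \<in># replicate_mset (dim (eigenspace M (b\<^sup>2))) (sqrt (b\<^sup>2))"
    using b0 by simp
  then have "b \<in># Q"
    unfolding Q_def set_mset_sum[OF \<open>finite E\<close>] using bE by blast
  define xs where "xs = sorted_list_of_multiset Q"
  have "b \<in> set xs" "sorted xs"
    using \<open>b \<in># Q\<close> by (auto simp: xs_def)
  then have "xs \<noteq> []"
    by auto
  have "singular_value B 1 = rev xs ! 0"
    by (simp add: singular_value_def singular_values_def xs_def Q_def E_def M_def Let_def)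
  also have "\<dots> = last xs"
    using \<open>xs \<noteq> []\<close> by (metis hd_conv_nth hd_rev rev_is_Nil_conv)
  also have "\<dots> \<ge> b"
    using \<open>b \<in> set xs\<close> \<open>sorted xs\<close> \<open>xs \<noteq> []\<close>
    by (induction xs) (auto split: if_splits)
  finally show ?thesis
    by (simp add: b_def)
qed

text \<open>The condition \<open>s \<le> 1\<close> enters here: for positive \<open>s\<close> the
  ceiling is 1, the product of earlier singular values is empty, and only a power of the largest one
  remains.\<close>

lemma onorm_powr_le_singular_value_function:
  fixes B :: "real^'n^'n"
  assumes "0 \<le> s" "s \<le> 1" "onorm ((*v) B) > 0"
  shows "onorm ((*v) B) powr s \<le> singular_value_function s B"
proof (cases "s = 0")
  case True
  with assms show ?thesis
    by (simp add: singular_value_function_def)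
next
  case False
  with assms have s: "0 < s" "nat \<lceil>s\<rceil> = 1"
    by (auto simp: ceiling_eq_iff nat_eq_iff)
  have "real CARD('n) \<ge> 1"
    by (simp add: Suc_leI)
  then have "s \<le> real CARD('n)"
    using assms by linarith
  with s have "singular_value_function s B = singular_value B 1 powr s"
    by (simp add: singular_value_function_def)
  then show ?thesis
    using onorm_le_singular_value_1[of B] assms by (simp add: powr_mono2)
qed

section \<open>Covering numbers and the upper box dimension\<close>

lemma covering_number_le:
  assumes "finite P" "E \<subseteq> (\<Union>x\<in>P. cball x (\<delta> / 2))"
  shows "covering_number \<delta> E \<le> card P"
  unfolding covering_number_def using assms by (intro Least_le) auto

text \<open>The \<open>LEAST\<close> in the definition is informative only if some finite cover
  exists. Compactness extracts one from open balls of the same radius.\<close>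

lemma covering_number_attained:
  assumes "compact E" "\<delta> > 0"
  obtains P where "finite P" "card P = covering_number \<delta> E" "E \<subseteq> (\<Union>x\<in>P. cball x (\<delta> / 2))"
proof -
  have "E \<subseteq> (\<Union>x\<in>E. ball x (\<delta> / 2))"
    using assms(2) by auto
  then obtain P where P: "finite P" "E \<subseteq> (\<Union>x\<in>P. ball x (\<delta> / 2))"
    by (rule compactE_image[OF assms(1) open_ball])
  have "(\<Union>x\<in>P. ball x (\<delta> / 2)) \<subseteq> (\<Union>x\<in>P. cball x (\<delta> / 2))"
    by (intro UN_mono ball_subset_cball) simp
  with P have "\<exists>k P. finite P \<and> card P = k \<and> E \<subseteq> (\<Union>x\<in>P. cball x (\<delta> / 2))"
    by blast
  then have "\<exists>P. finite P \<and> card P = covering_number \<delta> E \<and> E \<subseteq> (\<Union>x\<in>P. cball x (\<delta> / 2))"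
    unfolding covering_number_def by (rule LeastI_ex)
  then show ?thesis
    using that by blast
qed

lemma covering_number_mono:
  assumes "compact F" "\<delta> > 0" "E \<subseteq> F"
  shows "covering_number \<delta> E \<le> covering_number \<delta> F"
proof -
  obtain P where "finite P" "card P = covering_number \<delta> F" "F \<subseteq> (\<Union>x\<in>P. cball x (\<delta> / 2))"
    using covering_number_attained[OF assms(1,2)] .
  with assms(3) show ?thesis
    using covering_number_le[of P E \<delta>] by auto
qed

lemma covering_number_antimono:
  assumes "compact E" "0 < \<delta>" "\<delta> \<le> \<delta>'"
  shows "covering_number \<delta>' E \<le> covering_number \<delta> E"
proof -
  obtain P where P: "finite P" "card P = covering_number \<delta> E" "E \<subseteq> (\<Union>x\<in>P. cball x (\<delta> / 2))"
    using covering_number_attained[OF assms(1,2)] .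
  have "(\<Union>x\<in>P. cball x (\<delta> / 2)) \<subseteq> (\<Union>x\<in>P. cball x (\<delta>' / 2))"
    using assms(3) by (intro UN_mono subset_cball) auto
  with P show ?thesis
    using covering_number_le[of P E \<delta>'] by auto
qed

lemma covering_number_pos:
  assumes "compact E" "E \<noteq> {}" "\<delta> > 0"
  shows "covering_number \<delta> E \<ge> 1"
proof -
  obtain P where "finite P" "card P = covering_number \<delta> E" "E \<subseteq> (\<Union>x\<in>P. cball x (\<delta> / 2))"
    using covering_number_attained[OF assms(1,3)] .
  then show ?thesis
    using assms(2) by (metis UN_empty One_nat_def Suc_leI card_gt_0_iff subset_empty)
qed

lemma covering_number_Union_le:
  assumes "finite I" "\<And>i. i \<in> I \<Longrightarrow> compact (E i)" "\<delta> > 0"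
  shows "covering_number \<delta> (\<Union>i\<in>I. E i) \<le> (\<Sum>i\<in>I. covering_number \<delta> (E i))"
proof -
  have "\<exists>P. finite P \<and> card P = covering_number \<delta> (E i) \<and> E i \<subseteq> (\<Union>x\<in>P. cball x (\<delta> / 2))"
    if "i \<in> I" for i
    using covering_number_attained[OF assms(2)[OF that] assms(3)] by metis
  then obtain P where P: "\<And>i. i \<in> I \<Longrightarrow> finite (P i)"
      "\<And>i. i \<in> I \<Longrightarrow> card (P i) = covering_number \<delta> (E i)"
      "\<And>i. i \<in> I \<Longrightarrow> E i \<subseteq> (\<Union>x\<in>P i. cball x (\<delta> / 2))"
    by metis
  have "(\<Union>i\<in>I. E i) \<subseteq> (\<Union>x\<in>(\<Union>i\<in>I. P i). cball x (\<delta> / 2))"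
    using P(3) by fastforce
  then have "covering_number \<delta> (\<Union>i\<in>I. E i) \<le> card (\<Union>i\<in>I. P i)"
    using assms(1) P(1) by (intro covering_number_le) auto
  also have "\<dots> \<le> (\<Sum>i\<in>I. card (P i))"
    by (rule card_UN_le[OF assms(1)])
  finally show ?thesis
    using P(2) by simp
qed

lemma covering_number_Un_le:
  assumes "compact E" "compact F" "\<delta> > 0"
  shows "covering_number \<delta> (E \<union> F) \<le> covering_number \<delta> E + covering_number \<delta> F"
  using covering_number_Union_le[of "UNIV :: bool set" "\<lambda>b. if b then E else F" \<delta>] assms
  by (simp add: UNIV_bool Un_commute add.commute)

lemma covering_number_image_le:
  fixes f :: "'a::metric_space \<Rightarrow> 'b::metric_space"
  assumes "compact E" "\<delta> > 0" "L > 0" "\<And>x y. dist (f x) (f y) \<le> L * dist x y"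
  shows "covering_number \<delta> (f ` E) \<le> covering_number (\<delta> / L) E"
proof -
  obtain P where P: "finite P" "card P = covering_number (\<delta> / L) E"
      "E \<subseteq> (\<Union>x\<in>P. cball x (\<delta> / L / 2))"
    using covering_number_attained[OF assms(1), of "\<delta> / L"] assms(2,3) by auto
  have "f ` E \<subseteq> (\<Union>x\<in>f ` P. cball x (\<delta> / 2))"
  proof
    fix y assume "y \<in> f ` E"
    then obtain e x where e: "y = f e" "x \<in> P" "dist x e \<le> \<delta> / L / 2"
      using P(3) by auto
    have "dist (f x) y \<le> L * (\<delta> / L / 2)"
      using assms(4)[of x e] mult_left_mono[OF e(3), of L] assms(3) e(1) by simp
    with assms(3) e(2) show "y \<in> (\<Union>x\<in>f ` P. cball x (\<delta> / 2))"
      by auto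
  qed
  then have "covering_number \<delta> (f ` E) \<le> card (f ` P)"
    using P(1) by (intro covering_number_le) auto
  also have "\<dots> \<le> card P"
    by (rule card_image_le[OF P(1)])
  finally show ?thesis
    using P(2) by simp
qed

lemma eventually_at_right_0_less_1: "\<forall>\<^sub>F \<delta> in at_right (0::real). 0 < \<delta> \<and> \<delta> < 1"
  unfolding eventually_at_right_field by (rule exI[of _ 1]) simp

lemma upper_box_dim_mono:
  assumes "compact F" "E \<subseteq> F" "compact E" "E \<noteq> {}"
  shows "upper_box_dim E \<le> upper_box_dim F"
  unfolding upper_box_dim_def
proof (rule Limsup_mono)
  show "\<forall>\<^sub>F \<delta> in at_right 0. ereal (ln (real (covering_number \<delta> E)) / - ln \<delta>)
      \<le> ereal (ln (real (covering_number \<delta> F)) / - ln \<delta>)"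
    using eventually_at_right_0_less_1
  proof eventually_elim
    case (elim \<delta>)
    have "ln (real (covering_number \<delta> E)) \<le> ln (real (covering_number \<delta> F))"
      using covering_number_pos[OF assms(3,4), of \<delta>] covering_number_mono[OF assms(1) _ assms(2), of \<delta>] elim
      by simp
    then have "ln (real (covering_number \<delta> E)) / - ln \<delta> \<le> ln (real (covering_number \<delta> F)) / - ln \<delta>"
      using elim by (intro divide_right_mono) auto
    then show ?case
      by simp
  qed
qed

text \<open>The limsup controls only small scales. The constant \<open>K\<close> extends the bound
  to all scales up to 1, as needed for the rescaled values \<open>\<delta> / nrm w\<close>
  later.\<close>

lemma covering_number_bound_of_upper_box_dim_less:
  assumes "compact E" "E \<noteq> {}" "upper_box_dim E < ereal t" "t \<ge> 0"
  obtains K where "K > 0"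
    "\<And>\<delta>. 0 < \<delta> \<Longrightarrow> \<delta> \<le> 1 \<Longrightarrow> real (covering_number \<delta> E) \<le> K * \<delta> powr (-t)"
proof -
  have "\<forall>\<^sub>F \<delta> in at_right 0. ereal (ln (real (covering_number \<delta> E)) / - ln \<delta>) < ereal t"
    using assms(3) unfolding upper_box_dim_def by (rule Limsup_lessD)
  then obtain d where d: "d > 0"
      "\<And>\<delta>. 0 < \<delta> \<Longrightarrow> \<delta> < d \<Longrightarrow> ln (real (covering_number \<delta> E)) / - ln \<delta> < t"
    by (auto simp: eventually_at_right_field)
  \<comment> \<open>Halving keeps \<open>d'\<close> strictly below both \<open>d\<close> and 1, so
    below \<open>d'\<close> the limsup bound applies and \<open>- ln \<delta>\<close> is
    positive.\<close>
  define d' where "d' = min d 1 / 2"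
  have d': "0 < d'" "d' < d" "d' < 1"
    using d(1) by (auto simp: d'_def min_def)
  define K where "K = real (covering_number d' E)"
  have K: "K \<ge> 1"
    using covering_number_pos[OF assms(1,2) d'(1)] by (simp add: K_def)
  have "real (covering_number \<delta> E) \<le> K * \<delta> powr (-t)" if \<delta>: "0 < \<delta>" "\<delta> \<le> 1" for \<delta>
  proof (cases "\<delta> < d'")
    case True
    with \<delta> d' have "ln (real (covering_number \<delta> E)) / - ln \<delta> < t"
      by (intro d(2)) auto
    moreover have "- ln \<delta> > 0"
      using True d' \<delta> by simp
    ultimately have "ln (real (covering_number \<delta> E)) < t * (- ln \<delta>)"
      by (simp only: pos_divide_less_eq)
    then have "ln (real (covering_number \<delta> E)) \<le> - t * ln \<delta>"
      by simp
    moreover have "real (covering_number \<delta> E) > 0"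
      using covering_number_pos[OF assms(1,2) \<delta>(1)] by simp
    ultimately have "real (covering_number \<delta> E) \<le> \<delta> powr (-t)"
      using \<delta> by (metis exp_le_cancel_iff exp_ln less_irrefl powr_def)
    also have "\<dots> \<le> K * \<delta> powr (-t)"
      using K mult_right_mono[of 1 K "\<delta> powr (-t)"] by simp
    finally show ?thesis .
  next
    case False
    then have "real (covering_number \<delta> E) \<le> K"
      using covering_number_antimono[OF assms(1) d'(1), of \<delta>] by (simp add: K_def)
    also have "\<dots> \<le> K * \<delta> powr (-t)"
    proof -
      have "\<delta> powr (-t) \<ge> 1"
        using \<delta> assms(4) powr_mono2'[of "-t" \<delta> 1] by simp
      with K show ?thesis
        by simp
    qed
    finally show ?thesis .
  qed
  with K show ?thesis
    by (intro that[of K]) auto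
qed

text \<open>After taking logarithms the constant contributes \<open>ln K / - ln \<delta>\<close>,
  which vanishes in the limit.\<close>

lemma upper_box_dim_le_of_covering_number_bound:
  assumes "compact E" "E \<noteq> {}" "K > 0"
    "\<And>\<delta>. 0 < \<delta> \<Longrightarrow> \<delta> < 1 \<Longrightarrow> real (covering_number \<delta> E) \<le> K * \<delta> powr (-t)"
  shows "upper_box_dim E \<le> ereal t"
proof -
  have "upper_box_dim E \<le> Limsup (at_right 0) (\<lambda>\<delta>. ereal (ln K / - ln \<delta> + t))"
    unfolding upper_box_dim_def
  proof (rule Limsup_mono)
    show "\<forall>\<^sub>F \<delta> in at_right 0. ereal (ln (real (covering_number \<delta> E)) / - ln \<delta>)
        \<le> ereal (ln K / - ln \<delta> + t)"
      using eventually_at_right_0_less_1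
    proof eventually_elim
      case (elim \<delta>)
      have "ln (real (covering_number \<delta> E)) \<le> ln (K * \<delta> powr (-t))"
        using covering_number_pos[OF assms(1,2), of \<delta>] assms(4)[of \<delta>] elim by simp
      also have "\<dots> = ln K + t * (- ln \<delta>)"
        using elim assms(3) by (simp add: ln_mult ln_powr)
      finally have "ln (real (covering_number \<delta> E)) / - ln \<delta> \<le> (ln K + t * (- ln \<delta>)) / - ln \<delta>"
        using elim by (intro divide_right_mono) auto
      also have "\<dots> = ln K / - ln \<delta> + t"
        using elim by (simp add: field_simps)
      finally show ?case
        by simp
    qed
  qed
  also have "Limsup (at_right 0) (\<lambda>\<delta>. ereal (ln K / - ln \<delta> + t)) = ereal t"
  proof (rule lim_imp_Limsup)
    have "filterlim (\<lambda>\<delta>::real. - ln \<delta>) at_infinity (at_right 0)"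
      using ln_at_0 by (intro filterlim_at_top_imp_at_infinity) (simp add: filterlim_uminus_at_top)
    then have "((\<lambda>\<delta>. ln K / - ln \<delta> + t) \<longlongrightarrow> 0 + t) (at_right 0)"
      by (intro tendsto_add tendsto_divide_0[OF tendsto_const] tendsto_const)
    then show "((\<lambda>\<delta>. ereal (ln K / - ln \<delta> + t)) \<longlongrightarrow> ereal t) (at_right 0)"
      by simp
  qed simp
  finally show ?thesis .
qed

section \<open>Iterated function systems along words\<close>

text \<open>The order of composition matches \<open>word_matrix\<close>, which is therefore the
  linear part of \<open>word_map\<close> in the affine case.\<close>

definition word_map :: "(nat \<Rightarrow> 'a \<Rightarrow> 'a) \<Rightarrow> nat list \<Rightarrow> 'a \<Rightarrow> 'a" where
  "word_map S w = foldr (\<lambda>i g. S i \<circ> g) w id"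

lemma word_map_Nil [simp]: "word_map S [] = id"
  and word_map_Cons [simp]: "word_map S (i # w) = S i \<circ> word_map S w"
  by (simp_all add: word_map_def)

lemma word_map_snoc: "word_map S (w @ [i]) = word_map S w \<circ> S i"
  by (induction w) auto

lemma word_matrix_Nil [simp]: "word_matrix A [] = mat 1"
  and word_matrix_Cons [simp]: "word_matrix A (i # w) = A i ** word_matrix A w"
  by (simp_all add: word_matrix_def)

lemma word_map_affine_diff:
  "word_map (\<lambda>i. affine_map (A i) (v i)) w x - word_map (\<lambda>i. affine_map (A i) (v i)) w y
    = word_matrix A w *v (x - y)"
proof (induction w)
  case (Cons i w)
  then show ?case
    by (simp add: affine_map_def matrix_vector_mul_assoc[symmetric]
        matrix_vector_mult_diff_distrib[symmetric])
qed simp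

lemma dist_word_map_affine_le:
  "dist (word_map (\<lambda>i. affine_map (A i) (v i)) w x) (word_map (\<lambda>i. affine_map (A i) (v i)) w y)
    \<le> onorm ((*v) (word_matrix A w)) * dist x y"
  by (simp add: dist_norm word_map_affine_diff norm_matrix_vector_le)

lemma dist_affine_map_le:
  "dist (affine_map B u x) (affine_map B u y) \<le> onorm ((*v) B) * dist x y"
  using norm_matrix_vector_le[of B "x - y"]
  by (simp add: dist_norm affine_map_def matrix_vector_mult_diff_distrib)

lemma invertible_word_matrix:
  fixes A :: "nat \<Rightarrow> real^'n^'n"
  assumes "\<And>i. i \<in> I \<Longrightarrow> invertible (A i)" "w \<in> lists I"
  shows "invertible (word_matrix A w)"
  using assms(2)
proof induction
  case Nil
  have "mat 1 ** mat 1 = (mat 1 :: real^'n^'n)"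
    by simp
  then show ?case
    unfolding invertible_def word_matrix_Nil by blast
qed (simp add: assms(1) invertible_mult)

lemma onorm_pos_of_invertible:
  fixes B :: "real^'n^'n"
  assumes "invertible B"
  shows "onorm ((*v) B) > 0"
proof -
  obtain B' where "B' ** B = mat 1"
    using assms by (auto simp: invertible_def)
  then have "B *v x = 0 \<Longrightarrow> x = 0" for x
    by (metis matrix_vector_mul_assoc matrix_vector_mul_lid matrix_vector_mult_0_right)
  moreover have "(axis undefined 1 :: real^'n) \<noteq> 0"
    by simp
  ultimately have "onorm ((*v) B) \<noteq> 0"
    using onorm_eq_0[OF matrix_vector_mul_bounded_linear[of B]] by metis
  then show ?thesis
    using onorm_pos_le[OF matrix_vector_mul_bounded_linear[of B]] by simp
qed

lemma onorm_word_matrix_le: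
  assumes "\<And>i. i \<in> I \<Longrightarrow> onorm ((*v) (A i)) \<le> c" "w \<in> lists I"
  shows "onorm ((*v) (word_matrix A w)) \<le> c ^ length w"
  using assms(2)
proof induction
  case Nil
  then show ?case
    by (simp add: onorm_le)
next
  case (Cons i w)
  have "0 \<le> onorm ((*v) (A i))" "0 \<le> onorm ((*v) (word_matrix A w))"
    by (auto intro: onorm_pos_le matrix_vector_mul_bounded_linear)
  then have "onorm ((*v) (A i)) * onorm ((*v) (word_matrix A w)) \<le> c * c ^ length w"
    using Cons assms(1)[of i] by (intro mult_mono) auto
  then show ?case
    using onorm_matrix_mul_le[of "A i" "word_matrix A w"] by simp
qed

text \<open>A bound on the length of the words in \<open>W\<close> forces every address of a point to leave \<open>W\<close>.\<close>

lemma attractor_subset_along_words: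
  assumes "is_attractor N S C F" "[] \<in> W" "\<And>w. w \<in> W \<Longrightarrow> length w < m"
  shows "F \<subseteq> (\<Union>w\<in>W. word_map S w ` C) \<union>
             (\<Union>w\<in>(\<Union>w\<in>W. (\<lambda>i. w @ [i]) ` {1..N}) - W. word_map S w ` F)"
    (is "F \<subseteq> ?R")
proof
  fix x assume x: "x \<in> F"
  have F: "F = (\<Union>i\<in>{1..N}. S i ` F) \<union> C"
    using assms(1) by (simp add: is_attractor_def)
  \<comment> \<open>After \<open>k\<close> substitutions either \<open>x\<close> is already covered
    or its address still lies in \<open>W\<close>. At \<open>k = m\<close> the second case is
    impossible.\<close>
  have "x \<in> ?R \<or> (\<exists>w\<in>W. length w = k \<and> x \<in> word_map S w ` F)" for k
  proof (induction k)
    case 0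
    then show ?case
      using x assms(2) by force
  next
    case (Suc k)
    then show ?case
    proof
      assume "\<exists>w\<in>W. length w = k \<and> x \<in> word_map S w ` F"
      then obtain w y where w: "w \<in> W" "length w = k" "x = word_map S w y" "y \<in> F"
        by blast
      from w(4) F consider "y \<in> C" | i z where "i \<in> {1..N}" "z \<in> F" "y = S i z"
        by blast
      then show ?case
      proof cases
        case 1
        with w show ?thesis
          by blast
      next
        case 2
        then have "x \<in> word_map S (w @ [i]) ` F"
          using w by (auto simp: word_map_snoc)
        moreover have "w @ [i] \<in> (\<Union>w\<in>W. (\<lambda>i. w @ [i]) ` {1..N})"
          using w 2 by blast
        moreover have "length (w @ [i]) = Suc k"
          using w by simp
        ultimately show ?thesis
          by blast
      qed
    qed blast
  qed
  from this[of m] show "x \<in> ?R"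
    using assms(3) by blast
qed

text \<open>A point of \<open>F\<^sub>\<emptyset>\<close> farthest from \<open>F\<^sub>C\<close> is the image under a contraction of one that is
  at most as far away, so the distance is zero.\<close>

lemma homogeneous_attractor_subset:
  fixes F :: "'a::heine_borel set"
  assumes F0: "is_attractor N S {} F0" and F: "is_attractor N S C F"
    and contr: "\<And>i. i \<in> {1..N} \<Longrightarrow> L i < 1"
      "\<And>i x y. i \<in> {1..N} \<Longrightarrow> dist (S i x) (S i y) \<le> L i * dist x y"
  shows "F0 \<subseteq> F"
proof -
  have cpt: "compact F0" "F0 \<noteq> {}" "compact F" "F \<noteq> {}"
    using F0 F by (auto simp: is_attractor_def)
  have "continuous_on F0 (\<lambda>x. infdist x F)"
    by (intro continuous_intros)
  then obtain x where x: "x \<in> F0" "\<And>y. y \<in> F0 \<Longrightarrow> infdist y F \<le> infdist x F"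
    using continuous_attains_sup[OF cpt(1,2)] by metis
  obtain i y where i: "i \<in> {1..N}" "y \<in> F0" "x = S i y"
    using F0 x(1) unfolding is_attractor_def by blast
  obtain z where z: "z \<in> F" "infdist y F = dist y z"
    using infdist_attains_inf[OF compact_imp_closed[OF cpt(3)] cpt(4)] by metis
  have "S i z \<in> F"
    using F i z unfolding is_attractor_def by blast
  then have "infdist x F \<le> dist (S i y) (S i z)"
    using i(3) by (simp add: infdist_le)
  also have "\<dots> \<le> L i * infdist y F"
    using contr(2)[OF i(1)] z(2) by simp
  finally have le: "infdist x F \<le> L i * infdist y F" .
  have "infdist x F \<le> 0"
  proof (rule ccontr)
    assume "\<not> infdist x F \<le> 0"
    then have "infdist y F > 0"
      using le infdist_nonneg[of y F] by (cases "infdist y F = 0") auto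
    then have "L i * infdist y F < infdist y F"
      using contr(1)[OF i(1)] by simp
    then show False
      using le x(2)[OF i(2)] by linarith
  qed
  then have "infdist y F = 0" if "y \<in> F0" for y
    using x(2)[OF that] infdist_nonneg[of y F] by linarith
  then show ?thesis
    using in_closed_iff_infdist_zero[OF compact_imp_closed[OF cpt(3)] cpt(4)] by blast
qed

section \<open>Summability above the affinity dimension\<close>

text \<open>On level \<open>k\<close> the power \<open>t\<close> splits into the powers
  \<open>s\<close> and \<open>t - s\<close>. The first is at most the singular value function, whose
  level sums grow subexponentially; the second is at most \<open>c ^ k\<close> to the power
  \<open>t - s\<close>. The levels are thus dominated by a geometric series.\<close>

lemma bounded_sum_onorm_word_matrix_powr:
  fixes A :: "nat \<Rightarrow> real^'n^'n"
  assumes dim: "is_affinity_dimension N A s" and s: "s \<le> 1" and t: "s < t"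
    and inv: "\<And>i. i \<in> {1..N} \<Longrightarrow> invertible (A i)"
    and c: "0 < c" "c < 1" "\<And>i. i \<in> {1..N} \<Longrightarrow> onorm ((*v) (A i)) \<le> c"
  obtains Z where "\<And>W. finite W \<Longrightarrow> W \<subseteq> lists {1..N} \<Longrightarrow>
    (\<Sum>w\<in>W. onorm ((*v) (word_matrix A w)) powr t) \<le> Z"
proof -
  define nrm where "nrm w = onorm ((*v) (word_matrix A w))" for w
  define L where "L k = {w. length w = k \<and> set w \<subseteq> {1..N}}" for k
  define b where "b k = (\<Sum>w\<in>L k. nrm w powr t)" for k
  \<comment> \<open>This is \<open>c\<close> to the power \<open>(t - s) / 2\<close>: half of the
    decay absorbs the subexponential growth, the other half gives summability.\<close>
  define q where "q = exp ((t - s) * ln c / 2)"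
  have finL: "finite (L k)" for k
    using finite_lists_length_eq[of "{1..N}" k] by (simp add: L_def conj_commute)
  have Llists: "w \<in> lists {1..N}" if "w \<in> L k" for w k
    using that by (auto simp: L_def)
  have pos: "nrm w > 0" if "w \<in> lists {1..N}" for w
    unfolding nrm_def by (intro onorm_pos_of_invertible invertible_word_matrix[OF inv that])
  have s0: "s \<ge> 0"
    using dim by (simp add: is_affinity_dimension_def)
  have q: "0 < q" "q < 1"
    using c t by (auto simp: q_def mult_pos_neg)
  have lnc: "- ((t - s) * ln c / 2) > 0"
    using c t by (simp add: mult_pos_neg)
  have "(\<lambda>k. (1 / real k) * ln (\<Sum>w\<in>L k. singular_value_function s (word_matrix A w))) \<longlonglongrightarrow> 0"
    using dim by (simp add: is_affinity_dimension_def L_def)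
  from order_tendstoD(2)[OF this lnc]
  have "\<forall>\<^sub>F k in sequentially. norm (b k) \<le> q ^ k"
    \<comment> \<open>A positive \<open>k\<close> is needed to clear the factor
      \<open>1 / real k\<close>.\<close>
    using eventually_gt_at_top[of 0]
  proof eventually_elim
    case (elim k)
    define \<sigma> where "\<sigma> = (\<Sum>w\<in>L k. singular_value_function s (word_matrix A w))"
    have term_le: "nrm w powr s \<le> singular_value_function s (word_matrix A w)" if "w \<in> L k" for w
      using onorm_powr_le_singular_value_function[OF s0 s] pos[OF Llists[OF that]]
      by (simp add: nrm_def)
    have \<sigma>: "\<sigma> \<le> exp (- ((t - s) * ln c / 2) * real k)"
    \<comment> \<open>The logarithm yields a bound only for positive \<open>\<sigma>\<close>;
      otherwise the exponential bound is trivial.\<close>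
    proof (cases "\<sigma> > 0")
      case True
      have "ln \<sigma> < - ((t - s) * ln c / 2) * real k"
        using elim by (simp add: \<sigma>_def field_simps)
      with True show ?thesis
        by (metis exp_le_cancel_iff exp_ln less_imp_le)
    next
      case False
      then show ?thesis
        by (meson exp_ge_zero not_less order_trans)
    qed
    have "b k \<le> (\<Sum>w\<in>L k. singular_value_function s (word_matrix A w) * (c ^ k) powr (t - s))"
      unfolding b_def
    proof (rule sum_mono)
      fix w assume w: "w \<in> L k"
      have "nrm w \<le> c ^ length w"
        unfolding nrm_def by (rule onorm_word_matrix_le[OF c(3) Llists[OF w]])
      then have "nrm w \<le> c ^ k"
        using w by (simp add: L_def)
      then have "nrm w powr (t - s) \<le> (c ^ k) powr (t - s)"
        using t pos[OF Llists[OF w]] by (intro powr_mono2) auto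
      then have "nrm w powr s * nrm w powr (t - s)
          \<le> singular_value_function s (word_matrix A w) * (c ^ k) powr (t - s)"
        using term_le[OF w] by (intro mult_mono) (auto intro: order_trans[OF powr_ge_zero])
      then show "nrm w powr t \<le> singular_value_function s (word_matrix A w) * (c ^ k) powr (t - s)"
        by (simp flip: powr_add)
    qed
    also have "\<dots> = \<sigma> * (c ^ k) powr (t - s)"
      by (simp add: \<sigma>_def sum_distrib_right)
    also have "\<dots> \<le> exp (- ((t - s) * ln c / 2) * real k) * (c ^ k) powr (t - s)"
      by (intro mult_right_mono \<sigma>) auto
    also have "(c ^ k) powr (t - s) = exp ((t - s) * ln c * real k)"
      using c by (simp add: powr_def ln_realpow mult_ac)
    also have "exp (- ((t - s) * ln c / 2) * real k) * exp ((t - s) * ln c * real k) = q ^ k"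
      by (simp add: q_def field_simps flip: exp_add exp_of_nat_mult)
    finally have "b k \<le> q ^ k" .
    moreover have "b k \<ge> 0"
      by (simp add: b_def sum_nonneg)
    ultimately show ?case
      by simp
  qed
  then have "summable b"
    by (rule summable_comparison_test_ev) (use q in \<open>simp add: summable_geometric\<close>)
  show ?thesis
  proof (rule that[of "suminf b"])
    fix W :: "nat list set" assume W: "finite W" "W \<subseteq> lists {1..N}"
    \<comment> \<open>Inserting 0 keeps \<open>Max\<close> meaningful for empty
      \<open>W\<close>.\<close>
    define m where "m = Suc (Max (insert 0 (length ` W)))"
    have "length w < m" if "w \<in> W" for w
      unfolding m_def less_Suc_eq_le using W(1) that by (intro Max_ge) auto
    then have "W \<subseteq> (\<Union>k<m. L k)"
      using W(2) by (auto simp: L_def)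
    then have "(\<Sum>w\<in>W. nrm w powr t) \<le> (\<Sum>w\<in>(\<Union>k<m. L k). nrm w powr t)"
      using finL by (intro sum_mono2) auto
    also have "\<dots> = (\<Sum>k<m. b k)"
      unfolding b_def using finL by (intro sum.UNION_disjoint) (auto simp: L_def)
    also have "\<dots> \<le> suminf b"
      by (intro sum_le_suminf \<open>summable b\<close>) (auto simp: b_def sum_nonneg)
    finally show "(\<Sum>w\<in>W. onorm ((*v) (word_matrix A w)) powr t) \<le> suminf b"
      by (simp add: nrm_def)
  qed
qed

section \<open>Counting balls for the inhomogeneous attractor\<close>

lemma uniform_contraction_ratio:
  assumes "finite I" "\<And>i. i \<in> I \<Longrightarrow> f i < (1::real)"
  obtains c where "0 < c" "c < 1" "\<And>i. i \<in> I \<Longrightarrow> f i \<le> c"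
\<comment> \<open>The extra element 1/2 makes the maximum positive and defined even for empty
  \<open>I\<close>.\<close>
proof (rule that[of "Max (insert (1/2) (f ` I))"])
  show "0 < Max (insert (1/2) (f ` I))" "Max (insert (1/2) (f ` I)) < 1"
    using assms by (auto simp: Max_gr_iff)
qed (use assms in auto)

text \<open>The constant must not depend on the scale, so \<open>Z\<close>, \<open>KC\<close> and
  \<open>M\<close> are all fixed before \<open>\<delta>\<close> is introduced.\<close>

lemma covering_number_attractor_bound:
  fixes A :: "nat \<Rightarrow> real^'n^'n"
  assumes ifs: "affine_ifs X N A v" and dim: "is_affinity_dimension N A s" and s: "s \<le> 1"
    and F: "is_attractor N (\<lambda>i. affine_map (A i) (v i)) C F"
    and C: "compact C" "C \<noteq> {}" and t: "s < t" "upper_box_dim C < ereal t"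
  obtains K where "K > 0"
    "\<And>\<delta>. 0 < \<delta> \<Longrightarrow> \<delta> < 1 \<Longrightarrow> real (covering_number \<delta> F) \<le> K * \<delta> powr (-t)"
proof -
  define S where "S i = affine_map (A i) (v i)" for i
  define nrm where "nrm w = onorm ((*v) (word_matrix A w))" for w
  have inv: "invertible (A i)" and contr: "onorm ((*v) (A i)) < 1" if "i \<in> {1..N}" for i
    using ifs that by (auto simp: affine_ifs_def)
  obtain c where c: "0 < c" "c < 1" "\<And>i. i \<in> {1..N} \<Longrightarrow> onorm ((*v) (A i)) \<le> c"
    using uniform_contraction_ratio[of "{1..N}" "\<lambda>i. onorm ((*v) (A i))"] contr by auto
  obtain Z where Z: "\<And>W. finite W \<Longrightarrow> W \<subseteq> lists {1..N} \<Longrightarrow> (\<Sum>w\<in>W. nrm w powr t) \<le> Z"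
    unfolding nrm_def using bounded_sum_onorm_word_matrix_powr[OF dim s t(1) inv c] by blast
  have Z0: "Z \<ge> 0"
    using Z[of "{}"] by simp
  have s0: "s \<ge> 0"
    using dim by (simp add: is_affinity_dimension_def)
  then have t0: "t \<ge> 0"
    using t(1) by simp
  obtain KC where KC: "KC > 0"
      "\<And>\<delta>. 0 < \<delta> \<Longrightarrow> \<delta> \<le> 1 \<Longrightarrow> real (covering_number \<delta> C) \<le> KC * \<delta> powr (-t)"
    using covering_number_bound_of_upper_box_dim_less[OF C t(2) t0] by blast
  have attr: "is_attractor N S C F"
    using F by (simp add: S_def[abs_def])
  then have cF: "compact F"
    by (simp add: is_attractor_def)
  have pos: "nrm w > 0" if "w \<in> lists {1..N}" for w
    unfolding nrm_def by (intro onorm_pos_of_invertible invertible_word_matrix[OF inv that])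
  have lip: "dist (word_map S w x) (word_map S w y) \<le> nrm w * dist x y" for w x y
    unfolding nrm_def S_def[abs_def] by (rule dist_word_map_affine_le)
  have cpt: "compact (word_map S w ` E)" if "compact E" for w E
  proof (rule compact_continuous_image[OF _ that])
    have "(nrm w)-lipschitz_on E (word_map S w)"
      using lip by (intro lipschitz_onI)
        (auto simp: nrm_def intro: onorm_pos_le matrix_vector_mul_bounded_linear)
    then show "continuous_on E (word_map S w)"
      by (rule lipschitz_on_continuous_on)
  qed
  define M where "M = real (covering_number 1 F)"
  have bound: "real (covering_number \<delta> F) \<le> (KC * Z + real N * Z * M) * \<delta> powr (-t)"
    if \<delta>: "0 < \<delta>" "\<delta> < 1" for \<delta>
  proof -
    define W where "W = {w \<in> lists {1..N}. nrm w > \<delta>}"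
    define V where "V = (\<Union>w\<in>W. (\<lambda>i. w @ [i]) ` {1..N})"
    \<comment> \<open>Since \<open>nrm w \<le> c ^ length w\<close>, words of length at least
      \<open>m\<close> cannot belong to \<open>W\<close>.\<close>
    obtain m where m: "c ^ m < \<delta>"
      using real_arch_pow_inv[OF \<delta>(1) c(2)] by blast
    have len: "length w < m" if "w \<in> W" for w
    proof (rule ccontr)
      assume "\<not> length w < m"
      then have "c ^ length w \<le> c ^ m"
        using c by (intro power_decreasing) auto
      moreover have "nrm w \<le> c ^ length w"
        unfolding nrm_def using that by (intro onorm_word_matrix_le[where I = "{1..N}"] c(3)) (auto simp: W_def)
      ultimately show False
        using that m by (simp add: W_def)
    qed
    have finW: "finite W"
    proof (rule finite_subset)
      show "W \<subseteq> {w. set w \<subseteq> {1..N} \<and> length w \<le> m}"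
        using len by (fastforce simp: W_def)
    qed (rule finite_lists_length_le, simp)
    have finV: "finite V"
      using finW by (simp add: V_def)
    have Wl: "W \<subseteq> lists {1..N}"
      by (auto simp: W_def)
    have Vl: "V \<subseteq> lists {1..N}"
      by (auto simp: V_def W_def)
    \<comment> \<open>The identity has norm 1, so \<open>\<delta> < 1\<close> puts the empty word
      into \<open>W\<close>.\<close>
    obtain e :: "real^'n" where "norm e = 1" "norm (mat 1 *v e) = onorm ((*v) (mat 1 :: real^'n^'n))"
      by (rule onorm_attained)
    then have "nrm [] = 1"
      by (simp add: nrm_def)
    then have "[] \<in> W"
      using \<delta> by (simp add: W_def)
    have "F \<subseteq> (\<Union>w\<in>W. word_map S w ` C) \<union> (\<Union>w\<in>V - W. word_map S w ` F)"
      unfolding V_def by (rule attractor_subset_along_words[OF attr \<open>[] \<in> W\<close> len])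
    moreover have cU: "compact (\<Union>w\<in>W. word_map S w ` C)" "compact (\<Union>w\<in>V - W. word_map S w ` F)"
      using finW finV cpt C(1) cF by (auto intro: compact_UN)
    ultimately have "covering_number \<delta> F \<le>
        covering_number \<delta> (\<Union>w\<in>W. word_map S w ` C) + covering_number \<delta> (\<Union>w\<in>V - W. word_map S w ` F)"
      by (meson covering_number_mono covering_number_Un_le compact_Un \<delta>(1) order_trans)
    also have "\<dots> \<le> (\<Sum>w\<in>W. covering_number \<delta> (word_map S w ` C)) +
        (\<Sum>w\<in>V - W. covering_number \<delta> (word_map S w ` F))"
      using finW finV cpt C(1) cF \<delta>(1) by (intro add_mono covering_number_Union_le) auto
    finally have "real (covering_number \<delta> F) \<le> (\<Sum>w\<in>W. real (covering_number \<delta> (word_map S w ` C))) +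
        (\<Sum>w\<in>V - W. real (covering_number \<delta> (word_map S w ` F)))"
      by (simp only: of_nat_le_iff flip: of_nat_sum of_nat_add)
    also have "\<dots> \<le> (\<Sum>w\<in>W. KC * \<delta> powr (-t) * nrm w powr t) + (\<Sum>w\<in>V - W. M)"
    proof (intro add_mono sum_mono)
      fix w assume w: "w \<in> W"
      then have n: "nrm w > \<delta>"
        by (simp add: W_def)
      have "real (covering_number \<delta> (word_map S w ` C)) \<le> real (covering_number (\<delta> / nrm w) C)"
        unfolding of_nat_le_iff using n \<delta> lip by (intro covering_number_image_le C(1)) auto
      also have "real (covering_number (\<delta> / nrm w) C) \<le> KC * (\<delta> / nrm w) powr (-t)"
        using n \<delta> by (intro KC(2)) auto
      also have "\<dots> = KC * \<delta> powr (-t) * nrm w powr t"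
        using n \<delta> by (simp add: powr_divide powr_minus field_simps)
      finally show "real (covering_number \<delta> (word_map S w ` C)) \<le> KC * \<delta> powr (-t) * nrm w powr t" .
    next
      fix w assume w: "w \<in> V - W"
      then have n: "0 < nrm w" "nrm w \<le> \<delta>"
        using pos Vl by (auto simp: W_def)
      have "covering_number \<delta> (word_map S w ` F) \<le> covering_number (\<delta> / nrm w) F"
        using n \<delta> lip by (intro covering_number_image_le cF) auto
      also have "\<dots> \<le> covering_number 1 F"
        using n by (intro covering_number_antimono cF) auto
      finally show "real (covering_number \<delta> (word_map S w ` F)) \<le> M"
        by (simp add: M_def)
    qed
    also have "\<dots> = KC * \<delta> powr (-t) * (\<Sum>w\<in>W. nrm w powr t) + real (card (V - W)) * M"
      by (simp add: sum_distrib_left)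
    also have "\<dots> \<le> KC * \<delta> powr (-t) * Z + (real N * (Z * \<delta> powr (-t))) * M"
    proof (intro add_mono mult_left_mono mult_right_mono)
      show "(\<Sum>w\<in>W. nrm w powr t) \<le> Z"
        by (rule Z[OF finW Wl])
      have "card (V - W) \<le> card V"
        using finV by (intro card_mono) auto
      also have "\<dots> \<le> (\<Sum>w\<in>W. card ((\<lambda>i. w @ [i]) ` {1..N}))"
        unfolding V_def by (rule card_UN_le[OF finW])
      also have "\<dots> \<le> (\<Sum>w\<in>W. N)"
        by (intro sum_mono order_trans[OF card_image_le]) auto
      finally have "real (card (V - W)) \<le> real N * real (card W)"
        by (simp add: mult.commute flip: of_nat_mult)
      \<comment> \<open>A Markov-type count: each word of \<open>W\<close> contributes at least
        \<open>\<delta> powr t\<close> to a sum bounded by \<open>Z\<close>.\<close>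
      moreover have "real (card W) \<le> Z * \<delta> powr (-t)"
      proof -
        have "real (card W) * \<delta> powr t = (\<Sum>w\<in>W. \<delta> powr t)"
          by simp
        also have "\<dots> \<le> (\<Sum>w\<in>W. nrm w powr t)"
          using \<delta> t0 by (intro sum_mono powr_mono2) (auto simp: W_def)
        also have "\<dots> \<le> Z"
          by (rule Z[OF finW Wl])
        finally show ?thesis
          using \<delta> by (simp add: powr_minus field_simps)
      qed
      ultimately show "real (card (V - W)) \<le> real N * (Z * \<delta> powr (-t))"
        by (meson mult_left_mono of_nat_0_le_iff order_trans)
    qed (use KC(1) in \<open>auto simp: M_def\<close>)
    also have "\<dots> = (KC * Z + real N * Z * M) * \<delta> powr (-t)"
      by (simp add: algebra_simps)
    finally show ?thesis .
  qed
  show ?thesis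
  \<comment> \<open>Only \<open>Z \<ge> 0\<close> is known, so 1 is added to make the constant
    strictly positive.\<close>
  proof (rule that[of "KC * Z + real N * Z * M + 1"])
    show "KC * Z + real N * Z * M + 1 > 0"
      using KC(1) Z0 by (intro add_nonneg_pos add_nonneg_nonneg mult_nonneg_nonneg) (auto simp: M_def)
    show "real (covering_number \<delta> F) \<le> (KC * Z + real N * Z * M + 1) * \<delta> powr (-t)"
      if "0 < \<delta>" "\<delta> < 1" for \<delta>
      by (rule order_trans[OF bound[OF that] mult_right_mono]) simp_all
  qed
qed

section \<open>The two dimension inequalities\<close>

theorem corollary2p3:
  fixes X C F0 FC :: "(real^'n) set"
    and N :: nat
    and A :: "nat \<Rightarrow> real^'n^'n"
    and v :: "nat \<Rightarrow> real^'n"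
    and s :: real
  assumes "compact X"
    and "affine_ifs X N A v"
    and "is_affinity_dimension N A s"
    and "compact C" and "C \<noteq> {}" and "C \<subseteq> X"
    and "is_attractor N (\<lambda>i. affine_map (A i) (v i)) {} F0"
    and "is_attractor N (\<lambda>i. affine_map (A i) (v i)) C FC"
    and "s \<le> 1"
  shows "max (upper_box_dim F0) (upper_box_dim C) \<le> upper_box_dim FC \<and>
         upper_box_dim FC \<le> max (ereal s) (upper_box_dim C)"
proof
  have cpt: "compact F0" "F0 \<noteq> {}" "compact FC" "FC \<noteq> {}"
    using assms(7,8) by (auto simp: is_attractor_def)
  have "F0 \<subseteq> FC"
    using assms(2) by (intro homogeneous_attractor_subset[OF assms(7,8),
        where L = "\<lambda>i. onorm ((*v) (A i))"]) (auto simp: affine_ifs_def dist_affine_map_le)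
  moreover have "C \<subseteq> FC"
    using assms(8) by (auto simp: is_attractor_def)
  ultimately show "max (upper_box_dim F0) (upper_box_dim C) \<le> upper_box_dim FC"
    using cpt assms(4,5) by (simp add: upper_box_dim_mono)
  show "upper_box_dim FC \<le> max (ereal s) (upper_box_dim C)"
  proof (rule ccontr)
    assume "\<not> ?thesis"
    \<comment> \<open>Density of the reals in \<open>ereal\<close> supplies a finite exponent
      strictly in the gap, even if the dimension of \<open>FC\<close> were infinite; the covering
      bound at \<open>t\<close> then contradicts the choice of \<open>t\<close>.\<close>
    then obtain t where t: "max (ereal s) (upper_box_dim C) < ereal t" "ereal t < upper_box_dim FC"
      using ereal_dense2 by (metis not_le)
    then have "s < t" "upper_box_dim C < ereal t"
      by auto
    from covering_number_attractor_bound[OF assms(2,3,9,8,4,5) this]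
    have "upper_box_dim FC \<le> ereal t"
      using upper_box_dim_le_of_covering_number_bound[OF cpt(3,4)] by metis
    with t(2) show False
      by simp
  qed
qed

end
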